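(* For any positive invertible matrix $S\in M_2(\mathbb{C})$ and any unitary matrix $U\in M_2(\mathbb{C})$, $$E_U\bigl(S\sharp (U^{*}S^{-1}U)\bigr)\geq I.$$
   Context: $M_n(\mathbb{C})$ is the space of $n\times n$ complex matrices, $I$ is the identity matrix, and $X\ge Y$ means that $X-Y$ is positive semidefinite. "Positive" means positive semidefinite (Hermitian), so a positive invertible matrix is a positive definite one. For positive invertible $X,Y\in M_n(\mathbb{C})$, the geometric mean is $X\sharp Y = X^{1/2}(X^{-1/2}YX^{-1/2})^{1/2}X^{1/2}$. For a unitary matrix $U$ with spectral decomposition $U=\sum_i z_iP_i$ (with $z_i\neq z_j$ for $i\ne j$, and $P_i$ the spectral projections), the map $E_U$ is defined by $E_U(X)=\sum_i P_iXP_i$. *)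

theory Defs
  imports "HOL-Analysis.Analysis"
begin

definition conj_transpose :: "complex^'n^'m \<Rightarrow> complex^'m^'n" where
  "conj_transpose A = (\<chi> i j. cnj (A $ j $ i))"

definition hermitian :: "complex^'n^'n \<Rightarrow> bool" where
  "hermitian A \<longleftrightarrow> conj_transpose A = A"

definition unitary :: "complex^'n^'n \<Rightarrow> bool" where
  "unitary U \<longleftrightarrow> conj_transpose U ** U = mat 1 \<and> U ** conj_transpose U = mat 1"

text \<open>For Hermitian \<open>A\<close> the quadratic form \<open>\<Sum>i. cnj (x $ i) * (A *v x) $ i\<close> is real,
  so taking its real part loses nothing.\<close>

definition positive_semidef :: "complex^'n^'n \<Rightarrow> bool" where
  "positive_semidef A \<longleftrightarrow> hermitian A \<and> (\<forall>x. 0 \<le> Re (\<Sum>i\<in>UNIV. cnj (x $ i) * (A *v x) $ i))"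

definition loewner_ge :: "complex^'n^'n \<Rightarrow> complex^'n^'n \<Rightarrow> bool" (infix "\<succeq>" 50) where
  "X \<succeq> Y \<longleftrightarrow> positive_semidef (X - Y)"

text \<open>Meaningful for positive \<open>A\<close> only, where the positive square root exists and is unique.\<close>

definition msqrt :: "complex^'n^'n \<Rightarrow> complex^'n^'n" where
  "msqrt A = (THE B. positive_semidef B \<and> B ** B = A)"

definition geometric_mean :: "complex^'n^'n \<Rightarrow> complex^'n^'n \<Rightarrow> complex^'n^'n" (infixl "\<sharp>" 70) where
  "X \<sharp> Y = msqrt X ** msqrt (matrix_inv (msqrt X) ** Y ** matrix_inv (msqrt X)) ** msqrt X"

definition eigenspace :: "complex^'n^'n \<Rightarrow> complex \<Rightarrow> (complex^'n) set" where
  "eigenspace U z = {v. U *v v = z *s v}"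

definition spectrum :: "complex^'n^'n \<Rightarrow> complex set" where
  "spectrum U = {z. \<exists>v. v \<noteq> 0 \<and> v \<in> eigenspace U z}"

definition orthogonal_projection :: "complex^'n^'n \<Rightarrow> bool" where
  "orthogonal_projection P \<longleftrightarrow> hermitian P \<and> P ** P = P"

definition spectral_projection :: "complex^'n^'n \<Rightarrow> complex \<Rightarrow> complex^'n^'n" where
  "spectral_projection U z =
     (THE P. orthogonal_projection P \<and> range (\<lambda>v. P *v v) = eigenspace U z)"

text \<open>The map \<open>E\<^sub>U\<close>. The spectral projections of \<open>U\<close> are indexed by its eigenvalues, so
  that distinct indices have distinct eigenvalues.\<close>

definition pinching :: "complex^'n^'n \<Rightarrow> complex^'n^'n \<Rightarrow> complex^'n^'n" where
  "pinching U X = (\<Sum>z\<in>spectrum U. spectral_projection U z ** X ** spectral_projection U z)"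

text \<open>\<open>U = (\<Sum>z\<in>Z. z P\<^sub>z)\<close> with nonzero, mutually orthogonal projections \<open>P\<^sub>z\<close> that
  resolve the identity. The scalar multiple \<open>z P\<^sub>z\<close> is written \<open>mat z ** P z\<close>. The lemmas
  below show that any such decomposition computes \<open>pinching U\<close>.\<close>

definition spectral_decomposition ::
  "complex^'n^'n \<Rightarrow> complex set \<Rightarrow> (complex \<Rightarrow> complex^'n^'n) \<Rightarrow> bool" where
  "spectral_decomposition U Z P \<longleftrightarrow>
     finite Z \<and>
     (\<forall>z\<in>Z. orthogonal_projection (P z) \<and> P z \<noteq> 0) \<and>
     (\<forall>z\<in>Z. \<forall>w\<in>Z. z \<noteq> w \<longrightarrow> P z ** P w = 0) \<and>
     (\<Sum>z\<in>Z. P z) = mat 1 \<and>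
     U = (\<Sum>z\<in>Z. mat z ** P z)"

lemma conj_transpose_mult: "conj_transpose (A ** B) = conj_transpose B ** conj_transpose A"
  by (simp add: conj_transpose_def matrix_matrix_mult_def vec_eq_iff mult.commute)

lemma mat_mult_vector: "mat z *v v = z *s (v :: complex^'n)"
  by (simp add: vec_eq_iff matrix_vector_mult_def mat_def if_distrib if_distribR cong: if_cong)

lemma matrix_mult_sum_left: "(\<Sum>z\<in>Z. A z) ** B = (\<Sum>z\<in>Z. A z ** (B :: complex^'n^'n))"
  by (induction Z rule: infinite_finite_induct) (simp_all add: matrix_matrix_mult_def vec_eq_iff algebra_simps sum.distrib)

lemma matrix_mult_sum_right: "B ** (\<Sum>z\<in>Z. A z) = (\<Sum>z\<in>Z. (B :: complex^'n^'n) ** A z)"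
  by (induction Z rule: infinite_finite_induct) (simp_all add: matrix_add_ldistrib)

lemma mat_commute: "mat z ** (A :: complex^'n^'n) = A ** mat z"
  by (simp add: vec_eq_iff matrix_matrix_mult_def mat_def if_distrib if_distribR mult.commute
      cong: if_cong)

lemma orthogonal_projection_unique:
  assumes "orthogonal_projection P" "orthogonal_projection Q"
    and "range (\<lambda>v. P *v v) = range (\<lambda>v. Q *v v)"
  shows "P = Q"
proof -
  have fix_range: "A ** B = B"
    if A: "orthogonal_projection A" and AB: "range (\<lambda>v. A *v v) = range (\<lambda>v. B *v v)"
    for A B :: "complex^'n^'n"
  proof -
    have "(A ** B) *v v = B *v v" for v
    proof -
      obtain w where w: "B *v v = A *v w" using AB by blast
      have "(A ** B) *v v = A *v (B *v v)" by (simp add: matrix_vector_mul_assoc)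
      also have "\<dots> = (A ** A) *v w" by (simp add: w matrix_vector_mul_assoc)
      finally show ?thesis using A w by (simp add: orthogonal_projection_def)
    qed
    then show ?thesis by (simp add: matrix_eq)
  qed
  have "P = conj_transpose (Q ** P)"
    using fix_range[of Q P] assms by (simp add: orthogonal_projection_def hermitian_def)
  also have "\<dots> = P ** Q"
    using assms by (simp add: conj_transpose_mult orthogonal_projection_def hermitian_def)
  also have "\<dots> = Q" using fix_range[of P Q] assms by simp
  finally show ?thesis .
qed

lemma spectral_decomposition_range:
  assumes dec: "spectral_decomposition U Z P" and "z \<in> Z"
  shows "range (\<lambda>v. P z *v v) = eigenspace U z"
    and "\<And>w v. w \<notin> Z \<Longrightarrow> v \<in> eigenspace U w \<Longrightarrow> v = 0"
proof -
  have fin: "finite Z" and one: "(\<Sum>z\<in>Z. P z) = mat 1" and U: "U = (\<Sum>z\<in>Z. mat z ** P z)"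
    and idem: "\<And>z. z \<in> Z \<Longrightarrow> P z ** P z = P z"
    and orth: "\<And>z w. z \<in> Z \<Longrightarrow> w \<in> Z \<Longrightarrow> z \<noteq> w \<Longrightarrow> P z ** P w = 0"
    using dec by (auto simp: spectral_decomposition_def orthogonal_projection_def)
  have PU: "P w ** U = mat w ** P w" if "w \<in> Z" for w
  proof -
    have "P w ** U = (\<Sum>z\<in>Z. mat z ** (P w ** P z))"
      unfolding U matrix_mult_sum_right
      by (intro sum.cong refl) (simp add: matrix_mul_assoc mat_commute[of _ "P w"])
    also have "\<dots> = (\<Sum>z\<in>Z. if z = w then mat w ** P w else 0)"
      using that by (intro sum.cong) (auto simp: idem orth)
    finally show ?thesis using fin that by simp
  qed
  have UP: "U ** P w = mat w ** P w" if "w \<in> Z" for w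
  proof -
    have "U ** P w = (\<Sum>z\<in>Z. mat z ** (P z ** P w))"
      unfolding U matrix_mult_sum_left by (simp add: matrix_mul_assoc)
    also have "\<dots> = (\<Sum>z\<in>Z. if z = w then mat w ** P w else 0)"
      using that by (intro sum.cong) (auto simp: idem orth)
    finally show ?thesis using fin that by simp
  qed
  have kill: "P w *v v = 0" if "w \<in> Z" "v \<in> eigenspace U x" "w \<noteq> x" for w v x
  proof -
    have "w *s (P w *v v) = P w *v (U *v v)"
      by (simp add: PU[OF that(1)] matrix_vector_mul_assoc flip: mat_mult_vector)
    also have "\<dots> = x *s (P w *v v)"
      using that(2) by (simp add: eigenspace_def vector_scalar_commute)
    finally show ?thesis using that(3) by (simp add: vec.scale_right_imp_eq)
  qed
  have resolve: "v = (\<Sum>w\<in>Z. P w *v v)" for v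
  proof -
    have "(\<Sum>w\<in>Z'. P w) *v v = (\<Sum>w\<in>Z'. P w *v v)" for Z'
      by (induction Z' rule: infinite_finite_induct)
        (simp_all add: matrix_vector_mult_add_rdistrib)
    then show ?thesis using one by (metis matrix_vector_mul_lid)
  qed
  show "v = 0" if "w \<notin> Z" "v \<in> eigenspace U w" for w v
    using resolve[of v] kill[OF _ that(2)] that(1) by (metis (no_types, lifting) sum.neutral)
  show "range (\<lambda>v. P z *v v) = eigenspace U z"
  proof (intro equalityI subsetI)
    fix v assume "v \<in> range (\<lambda>v. P z *v v)"
    then show "v \<in> eigenspace U z"
      by (auto simp: eigenspace_def matrix_vector_mul_assoc UP[OF \<open>z \<in> Z\<close>] simp flip: mat_mult_vector)
  next
    fix v assume v: "v \<in> eigenspace U z"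
    have "v = (\<Sum>w\<in>Z. if w = z then P z *v v else 0)"
      using kill[OF _ v] by (subst resolve) (auto intro!: sum.cong)
    then have "v = P z *v v" using fin \<open>z \<in> Z\<close> by simp
    then show "v \<in> range (\<lambda>v. P z *v v)" by (metis rangeI)
  qed
qed

lemma pinching_eq:
  assumes dec: "spectral_decomposition U Z P"
  shows "pinching U X = (\<Sum>z\<in>Z. P z ** X ** P z)"
proof -
  have P: "orthogonal_projection (P z)" "P z \<noteq> 0" if "z \<in> Z" for z
    using dec that by (auto simp: spectral_decomposition_def)
  have "Z \<noteq> {}"
  proof
    assume "Z = {}"
    then have "mat 1 = (0 :: complex^'a^'a)"
      using dec by (simp add: spectral_decomposition_def)
    then show False by (metis matrix_vector_mul_lid matrix_vector_mult_0 zero_neq_one)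
  qed
  have "spectrum U = Z"
  proof (intro equalityI subsetI)
    fix z assume "z \<in> spectrum U"
    then show "z \<in> Z"
      using spectral_decomposition_range(2)[OF dec] \<open>Z \<noteq> {}\<close> by (auto simp: spectrum_def)
  next
    fix z assume "z \<in> Z"
    then obtain v where "P z *v v \<noteq> 0" using P by (metis matrix_eq matrix_vector_mult_0)
    then show "z \<in> spectrum U"
      using spectral_decomposition_range(1)[OF dec \<open>z \<in> Z\<close>] by (auto simp: spectrum_def)
  qed
  moreover have "spectral_projection U z = P z" if "z \<in> Z" for z
    unfolding spectral_projection_def
    using P[OF that] spectral_decomposition_range(1)[OF dec that]
    by (intro the_equality) (metis orthogonal_projection_unique)+
  ultimately show ?thesis by (simp add: pinching_def)
qed

end

theory Submission
  imports Defs
begin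

text \<open>For positive invertible \<open>2 \<times> 2\<close> matrices, Cayley--Hamilton turns the square root of \<open>A\<close> into a
  positive multiple of \<open>A + \<surd>(det A) I\<close>, so \<open>X \<sharp> Y\<close> is a positive multiple of \<open>Y + s X\<close> with
  \<open>s\<^sup>2 = det Y / det X\<close>. With \<open>T = S\<inverse>\<close>, \<open>X = S\<close> and \<open>Y = U\<^sup>*TU\<close> one has \<open>s = det T\<close>, and \<open>s S\<close> is the
  adjugate \<open>(tr T) I - T\<close> of \<open>T\<close>; hence \<open>G = X \<sharp> Y\<close> satisfies \<open>m G = U\<^sup>*TU - T + (tr T) I\<close> for some \<open>m > 0\<close>.
  The pinching sends \<open>U\<^sup>*TU\<close> and \<open>T\<close> to the same matrix, so it sends \<open>G\<close> to the scalar matrix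
  \<open>(tr T / m) I = (tr G / 2) I\<close>. Since \<open>G\<close> is positive with determinant \<open>1\<close>, \<open>tr G \<ge> 2\<close>.\<close>

section \<open>Entrywise calculus for 2 by 2 matrices and algebra of scalar matrices\<close>

lemma matrix_eq_2_iff:
  "(A :: 'a^2^2) = B \<longleftrightarrow> A$1$1 = B$1$1 \<and> A$1$2 = B$1$2 \<and> A$2$1 = B$2$1 \<and> A$2$2 = B$2$2"
  by (auto simp: vec_eq_iff forall_2)

lemma matrix_mult_2:
  "((A :: 'a::semiring_1^2^2) ** B) $ i $ j = A$i$1 * B$1$j + A$i$2 * B$2$j"
  by (simp add: matrix_matrix_mult_def sum_2)

lemma matrix_vector_mult_2:
  "((A :: 'a::semiring_1^2^2) *v x) $ i = A$i$1 * x$1 + A$i$2 * x$2"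
  by (simp add: matrix_vector_mult_def sum_2)

lemma mat_2 [simp]:
  "(mat z :: 'a::zero^2^2) $ 1 $ 1 = z" "(mat z :: 'a^2^2) $ 1 $ 2 = 0"
  "(mat z :: 'a^2^2) $ 2 $ 1 = 0" "(mat z :: 'a^2^2) $ 2 $ 2 = z"
  by (simp_all add: mat_def)

lemma trace_2: "trace (A :: 'a::comm_semiring_1^2^2) = A$1$1 + A$2$2"
  by (simp add: trace_def sum_2)

lemmas matrix_2_simps = matrix_eq_2_iff matrix_mult_2 det_2 trace_2

lemma mat_mult_mat: "mat a ** mat b = (mat (a * b) :: complex^'n^'n)"
  by (simp add: matrix_eq mat_mult_vector flip: matrix_vector_mul_assoc)

lemma mat_mult_mult: "(mat a ** (A :: complex^'n^'n)) ** (mat b ** B) = mat (a * b) ** (A ** B)"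
proof -
  have "(mat a ** A) ** (mat b ** B) = mat a ** (A ** mat b) ** B"
    by (simp add: matrix_mul_assoc)
  also have "\<dots> = mat a ** mat b ** (A ** B)"
    unfolding mat_commute[of b A, symmetric] by (simp add: matrix_mul_assoc)
  finally show ?thesis by (simp add: mat_mult_mat)
qed

lemma matrix_add_rdistrib: "(A + B) ** C = A ** C + B ** (C :: complex^'n^'n)"
  by (simp add: vec_eq_iff matrix_matrix_mult_def distrib_right sum.distrib)

lemma matrix_diff_rdistrib: "(A - B) ** C = A ** C - B ** (C :: complex^'n^'n)"
  by (simp add: vec_eq_iff matrix_matrix_mult_def left_diff_distrib sum_subtractf)

lemma matrix_diff_ldistrib: "A ** (B - C) = A ** B - A ** (C :: complex^'n^'n)"
  by (simp add: vec_eq_iff matrix_matrix_mult_def right_diff_distrib sum_subtractf)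

section \<open>Adjoints and positive semidefiniteness\<close>

lemma conj_transpose_nth [simp]: "conj_transpose A $ i $ j = cnj (A $ j $ i)"
  by (simp add: conj_transpose_def)

lemma conj_transpose_add: "conj_transpose (A + B) = conj_transpose A + conj_transpose B"
  by (simp add: vec_eq_iff)

lemma conj_transpose_diff: "conj_transpose (A - B) = conj_transpose A - conj_transpose B"
  by (simp add: vec_eq_iff)

lemma conj_transpose_mat: "conj_transpose (mat z) = mat (cnj z)"
  by (simp add: vec_eq_iff mat_def)

lemma conj_transpose_involution [simp]: "conj_transpose (conj_transpose A) = A"
  by (simp add: vec_eq_iff)

lemma conj_transpose_quadratic_form:
  "(\<Sum>i\<in>UNIV. cnj (x $ i) * (conj_transpose C *v y) $ i) =
   (\<Sum>i\<in>UNIV. cnj ((C *v x) $ i) * (y :: complex^'n) $ i)"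
proof -
  have "(\<Sum>i\<in>UNIV. cnj (x $ i) * (conj_transpose C *v y) $ i) =
      (\<Sum>i\<in>UNIV. \<Sum>j\<in>UNIV. cnj (C $ j $ i) * cnj (x $ i) * y $ j)"
    by (simp add: matrix_vector_mult_def sum_distrib_left mult_ac)
  also have "\<dots> = (\<Sum>j\<in>UNIV. \<Sum>i\<in>UNIV. cnj (C $ j $ i) * cnj (x $ i) * y $ j)"
    by (rule sum.swap)
  finally show ?thesis
    by (simp add: matrix_vector_mult_def sum_distrib_right)
qed

text \<open>The quadratic form of \<open>conj_transpose C ** A ** C\<close> at \<open>x\<close> is
  that of \<open>A\<close> at \<open>C *v x\<close>.\<close>

lemma positive_semidef_congruence:
  fixes A C :: "complex^'n^'n"
  assumes "positive_semidef A"
  shows "positive_semidef (conj_transpose C ** A ** C)"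
proof -
  have "(\<Sum>i\<in>UNIV. cnj (x $ i) * ((conj_transpose C ** A ** C) *v x) $ i) =
      (\<Sum>i\<in>UNIV. cnj ((C *v x) $ i) * (A *v (C *v x)) $ i)" for x
    by (simp add: conj_transpose_quadratic_form flip: matrix_vector_mul_assoc)
  with assms show ?thesis
    by (simp add: positive_semidef_def hermitian_def conj_transpose_mult matrix_mul_assoc)
qed

lemma positive_semidef_mat_of_real:
  assumes "0 \<le> r"
  shows "positive_semidef (mat (of_real r) :: complex^'n^'n)"
proof -
  have "0 \<le> Re (cnj z * (of_real r * z))" for z
  proof -
    have "Re (cnj z * (of_real r * z)) = r * (Re z * Re z + Im z * Im z)"
      by (simp add: algebra_simps)
    then show ?thesis using assms by simp
  qed
  then show ?thesis
    unfolding positive_semidef_def hermitian_def mat_mult_vector vector_smult_component Re_sum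
    by (simp only: conj_transpose_mat complex_cnj_complex_of_real sum_nonneg simp_thms)
qed

lemma positive_semidef_add:
  assumes "positive_semidef A" "positive_semidef B"
  shows "positive_semidef (A + B)"
  using assms by (simp add: positive_semidef_def hermitian_def conj_transpose_add
      matrix_vector_mult_add_rdistrib distrib_left sum.distrib)

text \<open>Scaling by \<open>r\<close> is congruence by the scalar matrix of
  \<open>sqrt r\<close>.\<close>

lemma positive_semidef_scale:
  fixes A :: "complex^'n^'n"
  assumes "positive_semidef A" "0 \<le> r"
  shows "positive_semidef (mat (of_real r) ** A)"
proof -
  let ?c = "mat (of_real (sqrt r)) :: complex^'n^'n"
  have "conj_transpose ?c ** A ** ?c = mat (of_real r) ** A"
    using assms(2) by (simp add: conj_transpose_mat mat_mult_mat matrix_mul_assoc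
        flip: mat_commute[of _ "mat _ ** A"] of_real_mult)
  then show ?thesis using positive_semidef_congruence[OF assms(1), of ?c] by simp
qed

text \<open>Hermitian symmetry makes both invariants real, and testing the quadratic form on
  suitable vectors makes them nonnegative.\<close>

lemma positive_semidef_trace_det_2:
  fixes A :: "complex^2^2"
  assumes "positive_semidef A"
  obtains t d :: real where "trace A = of_real t" "det A = of_real d" "0 \<le> t" "0 \<le> d"
proof -
  have h: "cnj (A$j$i) = A$i$j" for i j
    using assms by (metis positive_semidef_def hermitian_def conj_transpose_nth)
  define a c b where "a = Re (A$1$1)" "c = Re (A$2$2)" "b = A$1$2"
  have e: "A$1$1 = of_real a" "A$2$2 = of_real c" "A$1$2 = b" "A$2$1 = cnj b"
    using h[of 1 1] h[of 2 2] h[of 1 2]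
    by (auto simp: a_c_b_def complex_eq_iff)
  have q: "0 \<le> a * (cmod x)^2 + c * (cmod y)^2 + 2 * Re (cnj x * b * y)" for x y
  proof -
    have "0 \<le> Re (\<Sum>i\<in>UNIV. cnj (vector [x,y] $ i) * (A *v vector [x,y]) $ i)"
      using assms by (simp only: positive_semidef_def)
    then show ?thesis
      unfolding cmod_power2
      by (simp add: sum_2 matrix_vector_mult_2 vector_2 e power2_eq_square algebra_simps)
  qed
  have a0: "0 \<le> a" and c0: "0 \<le> c" using q[of 1 0] q[of 0 1] by auto
  have qb: "Re (cnj b * b) = (cmod b)^2" "Re (b * cnj b) = (cmod b)^2"
    by (simp_all only: cmod_power2) (simp_all add: power2_eq_square)
  \<comment> \<open>These are the cross terms of the form at \<open>(-b, a)\<close> and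
    \<open>(c, - cnj b)\<close>, the columns of the adjugate of \<open>A\<close>, and at
    \<open>(-b, 1)\<close>. Each adjugate column is killed by one row of \<open>A\<close>, so the
    form there is a diagonal entry times the determinant.\<close>
  have "Re (cnj (- b) * b * of_real a) = - a * Re (cnj b * b)"
    "Re (cnj (of_real c) * b * (- cnj b)) = - c * Re (b * cnj b)"
    "Re (cnj (- b) * b * 1) = - Re (cnj b * b)"
    by (simp_all add: algebra_simps)
  note qb = this[unfolded qb]
  have "0 \<le> a * (a * c - (cmod b)^2)"
    using q[of "- b" "of_real a"] unfolding qb by (simp add: power2_eq_square algebra_simps)
  moreover have "0 \<le> c * (a * c - (cmod b)^2)"
    using q[of "of_real c" "- cnj b"] unfolding qb by (simp add: power2_eq_square algebra_simps)
  \<comment> \<open>With a zero diagonal the two products above say nothing about \<open>b\<close>;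
    here the form at \<open>(-b, 1)\<close> is \<open>-2 |b|^2\<close>, which forces
    \<open>b = 0\<close>.\<close>
  moreover have "b = 0" if "a = 0" "c = 0"
    using q[of "- b" 1] that unfolding qb by simp
  ultimately have d0: "0 \<le> a * c - (cmod b)^2"
    using a0 c0 by (cases "a = 0"; cases "c = 0") (auto simp: zero_le_mult_iff mult_le_0_iff)
  show thesis
    by (rule that[of "a + c" "a * c - (cmod b)^2"])
      (use a0 c0 d0 in \<open>simp_all add: trace_2 det_2 e complex_norm_square[symmetric]\<close>)
qed

section \<open>Square roots through Cayley-Hamilton\<close>

lemma cayley_hamilton_2:
  "(A :: complex^2^2) ** A + mat (det A) = mat (trace A) ** A"
  by (simp add: matrix_2_simps algebra_simps)

text \<open>Cayley-Hamilton for a positive root \<open>B\<close> of \<open>A\<close> expresses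
  \<open>A + det B I\<close> as \<open>trace B\<close> times \<open>B\<close>. Thus \<open>r\<close>
  and \<open>s\<close> are the trace and the determinant of the root, and invertibility of
  \<open>A\<close> makes them strictly positive.\<close>

lemma msqrt_2:
  fixes A :: "complex^2^2"
  assumes psd: "positive_semidef A" and inv: "invertible A"
  obtains r s :: real where "0 < r" "0 < s" "det A = of_real (s^2)"
    "mat (of_real r) ** msqrt A = A + mat (of_real s)"
    "positive_semidef (msqrt A)" "msqrt A ** msqrt A = A"
proof -
  obtain t d where td: "trace A = of_real t" "det A = of_real d" "0 \<le> t" "0 \<le> d"
    using positive_semidef_trace_det_2[OF psd] .
  have "d > 0" using td inv by (simp add: invertible_det_nz)
  \<comment> \<open>The values are forced: \<open>det B ^ 2 = det A\<close> gives \<open>s\<close>,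
    and the trace of \<open>r B = A + s I\<close> gives \<open>r^2 = t + 2 s\<close>.\<close>
  define s r where "s = sqrt d" and "r = sqrt (t + 2 * s)"
  have s: "0 < s" "s^2 = d" using \<open>d > 0\<close> by (simp_all add: s_def)
  have r: "0 < r" "r^2 = t + 2 * s" using td s by (simp_all add: r_def)
  define B :: "complex^2^2" where "B = mat (of_real (1 / r)) ** (A + mat (of_real s))"
  have rB: "mat (of_real r) ** B = A + mat (of_real s)"
    using r by (simp add: B_def matrix_mul_assoc mat_mult_mat)
  have psdB: "positive_semidef B"
    unfolding B_def using r s psd
    by (intro positive_semidef_scale positive_semidef_add positive_semidef_mat_of_real) auto
  \<comment> \<open>Since \<open>s^2 = det A\<close>, Cayley-Hamilton turns
    \<open>A^2 + s^2 I\<close> into \<open>t A\<close>, leaving \<open>(t + 2 s) A\<close>.\<close>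
  have *: "(A + mat (of_real s)) ** (A + mat (of_real s)) = mat (of_real (r^2)) ** A"
  proof -
    have "(A + mat (of_real s)) ** (A + mat (of_real s))
        = (A ** A + mat (of_real (s^2))) + mat (of_real (2 * s)) ** A"
      by (simp add: matrix_2_simps td flip: s(2)) (simp add: algebra_simps power2_eq_square)
    then show ?thesis
      using cayley_hamilton_2[of A]
      by (simp add: td r(2) s(2)) (simp add: matrix_2_simps algebra_simps)
  qed
  have BB: "B ** B = A"
  proof -
    have "B ** B = mat (of_real (1 / r) * of_real (1 / r)) ** (mat (of_real (r\<^sup>2)) ** A)"
      by (simp only: B_def mat_mult_mult *)
    also have "\<dots> = mat (of_real (1 / r * (1 / r) * r^2)) ** A"
      by (simp only: matrix_mul_assoc mat_mult_mat of_real_mult)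
    also have "1 / r * (1 / r) * r^2 = 1" using r(1) by (simp add: power2_eq_square)
    finally show ?thesis by simp
  qed
  \<comment> \<open>Any positive root \<open>C\<close> has determinant \<open>s\<close>, so
    \<open>trace C\<close> times \<open>C\<close> equals \<open>A + s I\<close>. Taking traces gives
    \<open>(trace C)^2 = r^2\<close>, and nonnegativity fixes the sign.\<close>
  have uniq: "C = B" if C: "positive_semidef C" "C ** C = A" for C
  proof -
    obtain t' d' where td': "trace C = of_real t'" "det C = of_real d'" "0 \<le> t'" "0 \<le> d'"
      using positive_semidef_trace_det_2[OF C(1)] .
    have "det A = det C * det C" by (simp add: det_mul flip: C(2))
    then have "d = d'^2" by (simp add: td td' power2_eq_square flip: of_real_mult)
    then have "d' = s" using td' by (simp add: s_def)
    then have eq: "mat (of_real t') ** C = A + mat (of_real s)"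
      using cayley_hamilton_2[of C] C(2) td' by simp
    then have "trace (mat (of_real t') ** C) = trace (A + mat (of_real s))" by simp
    moreover have "trace (mat (of_real t') ** C) = of_real t' * trace C"
      by (simp add: matrix_2_simps algebra_simps)
    moreover have "trace (A + mat (of_real s)) = trace A + of_real (2 * s)"
      by (simp add: trace_2)
    ultimately have "(of_real (t'^2) :: complex) = of_real (r^2)"
      unfolding r(2) by (simp add: td td' power2_eq_square)
    then have "t' = r" using td'(3) r(1) by (simp only: of_real_eq_iff power2_eq_iff_nonneg less_imp_le)
    with eq rB have "mat (of_real r) ** C = mat (of_real r) ** B" by simp
    then have "mat (of_real (1/r)) ** (mat (of_real r) ** C) = mat (of_real (1/r)) ** (mat (of_real r) ** B)"
      by simp
    then show ?thesis using r by (simp add: matrix_mul_assoc mat_mult_mat)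
  qed
  have "msqrt A = B"
    unfolding msqrt_def using psdB BB uniq by (intro the_equality) blast+
  moreover have "det A = of_real (s\<^sup>2)" using td(2) s(2) by simp
  ultimately show thesis using that[OF r(1) s(1)] rB psdB BB by simp
qed

section \<open>Inverses and the geometric mean\<close>

lemma matrix_inv_right_left:
  fixes A :: "complex^'n^'n"
  assumes "invertible A"
  shows "A ** matrix_inv A = mat 1" "matrix_inv A ** A = mat 1"
proof -
  have "A ** matrix_inv A = mat 1 \<and> matrix_inv A ** A = mat 1"
    unfolding matrix_inv_def by (rule someI_ex[OF assms[unfolded invertible_def]])
  then show "A ** matrix_inv A = mat 1" "matrix_inv A ** A = mat 1" by simp_all
qed

lemma hermitian_matrix_inv:
  fixes A :: "complex^'n^'n"
  assumes "hermitian A" "invertible A"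
  shows "hermitian (matrix_inv A)"
proof -
  have "conj_transpose (A ** matrix_inv A) = mat 1"
    using matrix_inv_right_left[OF assms(2)] by (simp add: conj_transpose_mat)
  then have "conj_transpose (matrix_inv A) ** A = mat 1"
    using assms(1) by (simp add: conj_transpose_mult hermitian_def)
  then have "conj_transpose (matrix_inv A) ** (A ** matrix_inv A) = matrix_inv A"
    by (simp add: matrix_mul_assoc)
  then show ?thesis using matrix_inv_right_left[OF assms(2)] by (simp add: hermitian_def)
qed

text \<open>The inverse is the congruence of \<open>A\<close> by its own Hermitian inverse.\<close>

lemma positive_semidef_matrix_inv:
  fixes A :: "complex^'n^'n"
  assumes "positive_semidef A" "invertible A"
  shows "positive_semidef (matrix_inv A)"
proof -
  have "hermitian (matrix_inv A)"
    using assms by (simp add: hermitian_matrix_inv positive_semidef_def)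
  then have "conj_transpose (matrix_inv A) ** A ** matrix_inv A = matrix_inv A"
    using matrix_inv_right_left[OF assms(2)] by (simp add: hermitian_def)
  then show ?thesis using positive_semidef_congruence[OF assms(1), of "matrix_inv A"] by simp
qed

text \<open>Apply \<open>msqrt_2\<close> to the inner matrix \<open>C\<close> of the mean and
  multiply by \<open>R = msqrt X\<close> on both sides: \<open>C\<close> becomes \<open>Y\<close>
  and \<open>s I\<close> becomes \<open>s X\<close>. The determinant is given squared, which avoids
  choosing a root of a complex number.\<close>

lemma geometric_mean_2:
  fixes X Y :: "complex^2^2"
  assumes X: "positive_semidef X" "invertible X" and Y: "positive_semidef Y" "invertible Y"
  obtains m s :: real where "0 < m" "0 < s" "det Y = of_real (s^2) * det X"
    "mat (of_real m) ** (X \<sharp> Y) = Y + mat (of_real s) ** X"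
    "positive_semidef (X \<sharp> Y)" "det (X \<sharp> Y) ^ 2 = det X * det Y"
proof -
  define R where "R = msqrt X"
  have R: "positive_semidef R" "R ** R = X"
    using msqrt_2[OF X] by (metis R_def)+
  have invR: "invertible R"
    using X(2) by (simp add: invertible_det_nz det_mul flip: R(2))
  define Q where "Q = matrix_inv R"
  have Q: "R ** Q = mat 1" "Q ** R = mat 1"
    using matrix_inv_right_left[OF invR] by (simp_all add: Q_def)
  have hQ: "conj_transpose Q = Q" and hR: "conj_transpose R = R"
    using hermitian_matrix_inv[OF _ invR] R(1)
    by (simp_all add: Q_def hermitian_def positive_semidef_def)
  define C where "C = Q ** Y ** Q"
  have RCR: "R ** C ** R = Y"
  proof -
    have "R ** C ** R = (R ** Q) ** Y ** (Q ** R)" by (simp add: C_def matrix_mul_assoc)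
    then show ?thesis by (simp add: Q)
  qed
  have psdC: "positive_semidef C"
    using positive_semidef_congruence[OF Y(1), of Q] by (simp add: hQ C_def)
  have detY: "det Y = det C * det X"
    by (simp add: det_mul flip: RCR R(2))
  have invC: "invertible C" using Y(2) by (auto simp: invertible_det_nz detY)
  obtain m s where ms: "0 < m" "0 < s" "det C = of_real (s^2)"
    "mat (of_real m) ** msqrt C = C + mat (of_real s)"
    "positive_semidef (msqrt C)" "msqrt C ** msqrt C = C"
    using msqrt_2[OF psdC invC] .
  have G: "X \<sharp> Y = R ** msqrt C ** R"
    by (simp add: geometric_mean_def R_def Q_def C_def)
  have "mat (of_real m) ** (X \<sharp> Y) = R ** (mat (of_real m) ** msqrt C) ** R"
    by (simp add: G matrix_mul_assoc mat_commute[of _ R])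
  also have "\<dots> = Y + mat (of_real s) ** X"
    by (simp add: ms matrix_add_ldistrib matrix_add_rdistrib RCR)
      (metis R(2) mat_commute matrix_mul_assoc)
  finally have 1: "mat (of_real m) ** (X \<sharp> Y) = Y + mat (of_real s) ** X" .
  have 2: "positive_semidef (X \<sharp> Y)"
    using positive_semidef_congruence[OF ms(5), of R] by (simp add: hR G)
  have "det C = det (msqrt C) * det (msqrt C)"
    using ms(6) by (simp flip: det_mul)
  moreover have "det X = det R * det R" by (simp flip: R(2) det_mul)
  ultimately have 3: "det (X \<sharp> Y) ^ 2 = det X * det Y"
    by (simp add: detY G det_mul power2_eq_square)
  show thesis using that[OF ms(1,2) _ 1 2 3] ms(3) detY by simp
qed

section \<open>Spectral decomposition of a 2 by 2 unitary\<close>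

lemma eigenvector_exists_2:
  fixes U :: "complex^2^2"
  obtains z v where "v \<noteq> 0" "U *v v = z *s v"
proof -
  \<comment> \<open>A root of the characteristic polynomial, by the quadratic formula.\<close>
  define z where "z = (trace U + csqrt ((trace U)\<^sup>2 - 4 * det U)) / 2"
  have "2 * z - trace U = csqrt ((trace U)\<^sup>2 - 4 * det U)"
    by (simp add: z_def field_simps)
  then have "(2 * z - trace U)\<^sup>2 = (trace U)\<^sup>2 - 4 * det U"
    by (simp only: power2_csqrt)
  then have "4 * (z\<^sup>2 - trace U * z + det U) = 0"
    by (simp add: power2_eq_square algebra_simps)
  then have "z\<^sup>2 - trace U * z + det U = 0"
    by (metis mult_eq_0_iff zero_neq_numeral)
  then have "det (U - mat z) = 0"
    by (simp add: det_2 trace_2 power2_eq_square algebra_simps)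
  then have "\<not> invertible (U - mat z)" by (simp add: invertible_det_nz)
  then obtain v where v: "(U - mat z) *v v = 0" "v \<noteq> 0"
    by (metis invertible_left_inverse matrix_left_invertible_ker)
  have "U *v v = (U - mat z) *v v + mat z *v v"
    by (simp flip: matrix_vector_mult_add_rdistrib)
  then show thesis using that v by (simp add: mat_mult_vector)
qed

text \<open>The adjugate of \<open>X\<close> is \<open>mat (trace X) - X\<close>; for \<open>det Q = 0\<close> this reflects that \<open>Q\<close>
  has rank at most one.\<close>

lemma sandwich_2:
  fixes Q X :: "complex^2^2"
  shows "Q ** X ** Q = mat (trace (Q ** X)) ** Q - mat (det Q) ** (mat (trace X) - X)"
  by (simp add: matrix_2_simps algebra_simps)

text \<open>The witness is \<open>v v^* / |v|^2\<close>, the projection onto the line of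
  \<open>v\<close>; idempotence is Cayley-Hamilton with trace 1 and determinant 0. The last clause
  ranges over all matrices so that one \<open>P\<close> serves both a unitary and its
  adjoint.\<close>

lemma rank_one_projection_2:
  fixes v :: "complex^2"
  assumes "v \<noteq> 0"
  obtains P :: "complex^2^2" where "orthogonal_projection P" "trace P = 1" "det P = 0"
    "\<And>U z. U *v v = z *s v \<Longrightarrow> U ** P = mat z ** P"
proof -
  define n where "n = cmod (v$1) ^ 2 + cmod (v$2) ^ 2"
  have "v$1 \<noteq> 0 \<or> v$2 \<noteq> 0" using assms by (simp add: vec_eq_iff forall_2)
  then have n: "n \<noteq> 0" by (simp add: n_def add_nonneg_eq_0_iff)
  have nc: "complex_of_real n = v$1 * cnj (v$1) + v$2 * cnj (v$2)"
    by (simp only: n_def of_real_add complex_norm_square)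
  define P :: "complex^2^2" where "P = (\<chi> i j. v$i * cnj (v$j) / of_real n)"
  have P: "P $ i $ j = v$i * cnj (v$j) / of_real n" for i j by (simp add: P_def)
  have "conj_transpose P = P" by (simp add: matrix_eq_2_iff P mult.commute)
  moreover have tr: "trace P = 1" using n by (simp add: trace_2 P flip: add_divide_distrib nc)
  moreover have det: "det P = 0" by (simp add: det_2 P)
  moreover have "P ** P = P" using cayley_hamilton_2[of P] by (simp add: tr det)
  moreover have "U ** P = mat z ** P" if "U *v v = z *s v" for U z
  proof -
    have "U$i$1 * v$1 + U$i$2 * v$2 = z * v$i" for i
      using arg_cong[OF that, of "\<lambda>w. w $ i"] by (simp add: matrix_vector_mult_2)
    then have "U$i$1 * (v$1 * c) + U$i$2 * (v$2 * c) = z * (v$i * c)" for i c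
      by (metis distrib_right mult.assoc)
    then show ?thesis
      by (simp add: matrix_eq_2_iff matrix_mult_2 P flip: add_divide_distrib)
  qed
  ultimately show thesis using that by (simp add: orthogonal_projection_def hermitian_def)
qed

text \<open>An eigenvector of \<open>U\<close> is also one of its adjoint, so the projection
  \<open>P\<close> onto its line commutes with \<open>U\<close>. On the complementary line
  \<open>U\<close> must again act as a scalar.\<close>

lemma unitary_spectral_decomposition_2:
  fixes U :: "complex^2^2"
  assumes "unitary U"
  obtains Z P where "spectral_decomposition U Z P"
proof -
  obtain z v where v: "v \<noteq> 0" "U *v v = z *s v" using eigenvector_exists_2 .
  obtain P where P: "orthogonal_projection P" "trace P = 1" "det P = 0"
    and eig: "\<And>U z. U *v v = z *s v \<Longrightarrow> U ** P = mat z ** P"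
    using rank_one_projection_2[OF v(1)] by blast
  have PP: "P ** P = P" "conj_transpose P = P"
    using P by (auto simp: orthogonal_projection_def hermitian_def)
  have P0: "P \<noteq> 0" using P(2) by (auto simp: trace_2)
  have UP: "U ** P = mat z ** P" using eig v(2) .
  have "v = z *s (conj_transpose U *v v)"
  proof -
    have "conj_transpose U *v (U *v v) = v"
      using assms by (simp add: matrix_vector_mul_assoc unitary_def)
    then show ?thesis by (simp add: v(2) vector_scalar_commute)
  qed
  moreover from this v(1) have "z \<noteq> 0" by auto
  ultimately have "conj_transpose U *v v = inverse z *s v"
    by (metis left_inverse vector_smult_assoc vector_smult_lid)
  then have "conj_transpose U ** P = mat (inverse z) ** P" by (rule eig)
  from arg_cong[OF this, of conj_transpose]
  have PU': "P ** U = mat (cnj (inverse z)) ** P"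
    by (simp add: conj_transpose_mult PP conj_transpose_mat mat_commute)
  \<comment> \<open>Evaluating \<open>P ** U ** P\<close> from either side identifies the two
    scalars on \<open>P\<close>, so \<open>cnj (inverse z)\<close> can be replaced by
    \<open>z\<close> without computing \<open>|z|\<close>.\<close>
  have "mat (cnj (inverse z)) ** P = P ** U ** P"
    by (simp add: PU' PP flip: matrix_mul_assoc)
  also have "\<dots> = P ** mat z ** P"
    by (simp add: UP flip: matrix_mul_assoc)
  also have "\<dots> = mat z ** P"
    by (metis PP(1) mat_commute matrix_mul_assoc)
  finally have PU: "P ** U = mat z ** P" using PU' by simp
  define Q where "Q = mat 1 - P"
  have Q: "Q ** Q = Q" "P ** Q = 0" "Q ** P = 0" "P + Q = mat 1" "conj_transpose Q = Q"
    by (simp_all add: Q_def matrix_diff_ldistrib matrix_diff_rdistrib conj_transpose_diff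
        conj_transpose_mat PP)
  have "trace Q = 1" using P(2) by (simp add: Q_def trace_sub trace_I)
  then have Q0: "Q \<noteq> 0" by (auto simp: trace_2)
  have "det Q = 1 - trace P + det P" by (simp add: Q_def det_2 trace_2 algebra_simps)
  then have detQ: "det Q = 0" using P by simp
  \<comment> \<open>Since \<open>Q\<close> commutes with \<open>U\<close>,
    \<open>Q ** U = Q ** U ** Q\<close>; as \<open>det Q = 0\<close>, \<open>sandwich_2\<close>
    reduces this to the multiple \<open>trace (Q ** U)\<close> of \<open>Q\<close>.\<close>
  define w where "w = trace (Q ** U)"
  have "Q ** U = U ** Q" by (simp add: Q_def matrix_diff_ldistrib matrix_diff_rdistrib UP PU)
  then have "Q ** U = Q ** U ** Q" using Q(1) by (metis matrix_mul_assoc)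
  then have QU: "Q ** U = mat w ** Q" by (simp add: sandwich_2 detQ w_def)
  have "U = (P + Q) ** U" by (simp add: Q)
  then have U: "U = mat z ** P + mat w ** Q" by (simp add: matrix_add_rdistrib PU QU)
  show thesis
  \<comment> \<open>Projections are indexed by eigenvalues, so a repeated eigenvalue needs the
    single projection \<open>mat 1\<close> instead of \<open>P\<close> and \<open>Q\<close>.\<close>
  proof (cases "w = z")
    case True
    then have "U = mat z" using Q(4) by (simp add: U flip: matrix_add_ldistrib)
    moreover have "mat 1 \<noteq> (0 :: complex^2^2)" by (simp add: matrix_eq_2_iff)
    ultimately have "spectral_decomposition U {z} (\<lambda>_. mat 1)"
      by (simp add: spectral_decomposition_def orthogonal_projection_def hermitian_def conj_transpose_mat)
    then show thesis by (rule that)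
  next
    case False
    then have "spectral_decomposition U {z, w} (\<lambda>x. if x = z then P else Q)"
      using P(1) P0 Q Q0 U
      by (auto simp: spectral_decomposition_def orthogonal_projection_def hermitian_def)
    then show thesis by (rule that)
  qed
qed

section \<open>Linearity and unitary invariance of the pinching\<close>

lemma spectral_decomposition_mult:
  assumes dec: "spectral_decomposition U Z P" and z: "z \<in> Z"
  shows "U ** P z = mat z ** P z"
proof -
  have "(U ** P z) *v x = (mat z ** P z) *v x" for x
  proof -
    have "P z *v x \<in> eigenspace U z"
      using spectral_decomposition_range(1)[OF dec z] by blast
    then show ?thesis
      by (simp add: eigenspace_def mat_mult_vector flip: matrix_vector_mul_assoc)
  qed
  then show ?thesis by (simp add: matrix_eq)
qed

lemma pinching_mat:
  assumes "spectral_decomposition U Z P"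
  shows "pinching U (mat c) = mat c"
proof -
  have "P z ** mat c ** P z = mat c ** P z" if "z \<in> Z" for z
    using assms that by (auto simp: spectral_decomposition_def orthogonal_projection_def
        simp flip: mat_commute matrix_mul_assoc)
  then have "pinching U (mat c) = mat c ** (\<Sum>z\<in>Z. P z)"
    by (simp add: pinching_eq[OF assms] matrix_mult_sum_right)
  then show ?thesis using assms by (simp add: spectral_decomposition_def)
qed

lemma pinching_add:
  assumes "spectral_decomposition U Z P"
  shows "pinching U (X + Y) = pinching U X + pinching U Y"
  by (simp add: pinching_eq[OF assms] matrix_add_ldistrib matrix_add_rdistrib sum.distrib)

lemma pinching_scale:
  assumes "spectral_decomposition U Z P"
  shows "pinching U (mat c ** X) = mat c ** pinching U X"
proof -
  have "P z ** (mat c ** X) ** P z = mat c ** (P z ** X ** P z)" for z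
    by (simp add: matrix_mul_assoc mat_commute[of c "P z"])
  then show ?thesis by (simp add: pinching_eq[OF assms] matrix_mult_sum_right)
qed

text \<open>In the block of \<open>P z\<close>, the factor \<open>U\<close> contributes
  \<open>z\<close> and its adjoint contributes \<open>cnj z\<close>; the product acts on
  \<open>P z\<close> as 1.\<close>

lemma pinching_unitary_conj:
  assumes dec: "spectral_decomposition U Z P" and U: "unitary U"
  shows "pinching U (conj_transpose U ** X ** U) = pinching U X"
proof -
  have "P z ** (conj_transpose U ** X ** U) ** P z = P z ** X ** P z" if z: "z \<in> Z" for z
  proof -
    have UP: "U ** P z = mat z ** P z"
      by (rule spectral_decomposition_mult[OF dec z])
    have h: "conj_transpose (P z) = P z"  "P z ** P z = P z" "P z \<noteq> 0"
      using dec z by (auto simp: spectral_decomposition_def orthogonal_projection_def hermitian_def)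
    have PU: "P z ** conj_transpose U = mat (cnj z) ** P z"
      using arg_cong[OF UP, of conj_transpose]
      by (simp add: conj_transpose_mult h conj_transpose_mat mat_commute)
    \<comment> \<open>Inserting \<open>conj_transpose U ** U = mat 1\<close> between two copies of
      \<open>P z\<close> yields the absorption rule \<open>zz\<close>, which is all that is needed
      of \<open>|z| = 1\<close>.\<close>
    have "P z = P z ** (conj_transpose U ** U) ** P z" using U h by (simp add: unitary_def)
    also have "\<dots> = (P z ** conj_transpose U) ** (U ** P z)" by (simp add: matrix_mul_assoc)
    also have "\<dots> = mat (cnj z) ** (P z ** mat z) ** P z" by (simp add: PU UP matrix_mul_assoc)
    also have "\<dots> = mat (cnj z * z) ** P z"
      by (simp add: h mat_mult_mat matrix_mul_assoc flip: mat_commute[of z "P z"])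
        (simp add: h flip: matrix_mul_assoc)
    finally have zz: "P z = mat (cnj z * z) ** P z" .
    have "P z ** (conj_transpose U ** X ** U) ** P z = (P z ** conj_transpose U) ** X ** (U ** P z)"
      by (simp add: matrix_mul_assoc)
    also have "\<dots> = mat (cnj z) ** (P z ** X ** mat z) ** P z"
      by (simp add: PU UP matrix_mul_assoc)
    also have "\<dots> = mat (cnj z * z) ** P z ** X ** P z"
      by (simp add: mat_mult_mat matrix_mul_assoc flip: mat_commute[of z "P z ** X"])
    finally show ?thesis by (simp flip: zz)
  qed
  then show ?thesis by (simp add: pinching_eq[OF dec])
qed

section \<open>Trace bound and the final inequality\<close>

lemma hermitian_det_le_trace_2:
  fixes A :: "complex^2^2"
  assumes "hermitian A"
  shows "4 * Re (det A) \<le> (Re (trace A))\<^sup>2"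
proof -
  have h: "cnj (A$j$i) = A$i$j" for i j
    using assms by (metis hermitian_def conj_transpose_nth)
  have i: "Im (A$1$1) = 0" using h[of 1 1] by (auto simp: complex_eq_iff)
  have "A$2$1 = cnj (A$1$2)" using h by metis
  \<comment> \<open>The difference is the discriminant of the characteristic polynomial, here a sum
    of squares.\<close>
  then have "(Re (trace A))\<^sup>2 - 4 * Re (det A) = (Re (A$1$1) - Re (A$2$2))\<^sup>2 + 4 * (cmod (A$1$2))\<^sup>2"
    by (simp add: trace_2 det_2 i cmod_power2) (simp add: power2_eq_square algebra_simps)
  moreover have "\<dots> \<ge> 0" by simp
  ultimately show ?thesis by linarith
qed

theorem theorem4p1:
  fixes S U :: "complex^2^2"
  assumes "positive_semidef S" and "invertible S" and "unitary U"
  shows "pinching U (S \<sharp> (conj_transpose U ** matrix_inv S ** U)) \<succeq> mat 1"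
proof -
  define T where "T = matrix_inv S"
  define Y where "Y = conj_transpose U ** T ** U"
  have ST: "S ** T = mat 1"
    using matrix_inv_right_left[OF assms(2)] by (simp add: T_def)
  have detST: "det S * det T = 1"
    using arg_cong[OF ST, of det] by (simp add: det_mul)
  have psdT: "positive_semidef T"
    using positive_semidef_matrix_inv assms by (simp add: T_def)
  have psdY: "positive_semidef Y"
    using positive_semidef_congruence[OF psdT] by (simp add: Y_def)
  have UU: "conj_transpose U ** U = mat 1" "U ** conj_transpose U = mat 1"
    using assms(3) by (simp_all add: unitary_def)
  have detU: "det (conj_transpose U) * det U = 1"
    using arg_cong[OF UU(1), of det] by (simp add: det_mul)
  have detY: "det Y = det T"
    using detU by (simp add: Y_def det_mul mult_ac)
  have trY: "trace Y = trace T"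
  proof -
    have "trace Y = trace (U ** (conj_transpose U ** T))"
      unfolding Y_def by (rule trace_mul_sym)
    then show ?thesis by (simp add: matrix_mul_assoc UU)
  qed
  have invY: "invertible Y"
    using detST by (auto simp: invertible_det_nz detY)
  define G where "G = S \<sharp> Y"
  obtain m s where ms: "0 < m" "0 < s" "det Y = of_real (s^2) * det S"
    "mat (of_real m) ** G = Y + mat (of_real s) ** S"
    "positive_semidef G" "det G ^ 2 = det S * det Y"
    using geometric_mean_2[OF assms(1,2) psdY invY] unfolding G_def by blast
  obtain t d where td: "trace T = of_real t" "det T = of_real d" "0 \<le> t" "0 \<le> d"
    using positive_semidef_trace_det_2[OF psdT] .
  \<comment> \<open>Multiplying \<open>det Y = s^2 det S\<close> by \<open>det T\<close> and using
    \<open>det S det T = 1\<close> identifies \<open>s\<close> with \<open>det T\<close>.\<close>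
  have "det T ^ 2 = of_real (s^2) * (det S * det T)"
    using ms(3) by (simp add: detY power2_eq_square)
  then have "of_real (d^2) = (of_real (s^2) :: complex)"
    unfolding detST by (simp add: td)
  then have "d = s" using ms(2) td(4) by (simp only: of_real_eq_iff power2_eq_iff_nonneg less_imp_le)
  \<comment> \<open>Cayley-Hamilton for \<open>T\<close>, multiplied by \<open>S\<close> on the
    right.\<close>
  have sS: "mat (of_real s) ** S + T = mat (of_real t)"
  proof -
    have "(T ** T + mat (det T)) ** S = mat (trace T) ** T ** S"
      by (simp add: cayley_hamilton_2)
    moreover have "T ** S = mat 1"
      using matrix_inv_right_left[OF assms(2)] by (simp add: T_def)
    ultimately show ?thesis
      by (simp add: td \<open>d = s\<close> matrix_add_rdistrib add.commute flip: matrix_mul_assoc)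
  qed
  obtain t' d' where td': "trace G = of_real t'" "det G = of_real d'" "0 \<le> t'" "0 \<le> d'"
    using positive_semidef_trace_det_2[OF ms(5)] .
  have "of_real (d'^2) = (of_real 1 :: complex)"
    using ms(6) detST by (simp add: td' detY)
  then have "d' = 1" using td'(4) by (simp only: of_real_eq_iff) (simp add: power2_eq_1_iff)
  have "4 \<le> t'^2"
    using hermitian_det_le_trace_2[of G] ms(5) td' \<open>d' = 1\<close> by (simp add: positive_semidef_def)
  then have "2 \<le> t'" using td'(3) power2_le_imp_le[of 2 t'] by simp
  \<comment> \<open>Comparing traces expresses the unknown factor \<open>m\<close> through
    \<open>t\<close> and \<open>t' = trace G\<close>.\<close>
  have "of_real m * trace G = trace (mat (of_real m) ** G)"
    by (simp add: matrix_2_simps algebra_simps)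
  also have "\<dots> = trace T + trace (mat (of_real s) ** S)"
    by (simp add: ms(4) trace_add trY)
  also have "\<dots> = trace (mat (of_real s) ** S + T)" by (simp add: trace_add)
  also have "\<dots> = of_real (2 * t)" by (simp add: sS trace_2)
  finally have "of_real (m * t') = (of_real (2 * t) :: complex)" by (simp add: td')
  then have mt: "m * t' = 2 * t" by (simp only: of_real_eq_iff)
  obtain Z P where dec: "spectral_decomposition U Z P"
    using unitary_spectral_decomposition_2[OF assms(3)] .
  \<comment> \<open>The pinching cannot distinguish \<open>Y\<close> from \<open>T\<close>, so
    \<open>Y + s S\<close> may be replaced by \<open>T + s S\<close>, which is scalar by
    \<open>sS\<close>.\<close>
  have "mat (of_real m) ** pinching U G = pinching U T + pinching U (mat (of_real s) ** S)"
    using pinching_unitary_conj[OF dec assms(3), of T]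
    by (simp add: pinching_add[OF dec] ms(4) Y_def flip: pinching_scale[OF dec])
  also have "\<dots> = mat (of_real t)"
    by (simp add: pinching_mat[OF dec] sS add.commute[of T] flip: pinching_add[OF dec])
  finally have "mat (of_real (1/m)) ** (mat (of_real m) ** pinching U G) = mat (of_real (t/m))"
    by (simp add: mat_mult_mat)
  then have "pinching U G = mat (of_real (t/m))"
    using ms(1) by (simp add: matrix_mul_assoc mat_mult_mat)
  also have "t / m = t' / 2" using mt ms(1) by (simp add: field_simps)
  finally have "pinching U G - mat 1 = mat (of_real (t'/2 - 1))"
    by (simp add: matrix_eq_2_iff)
  then show ?thesis
    using positive_semidef_mat_of_real[of "t'/2 - 1"] \<open>2 \<le> t'\<close>
    by (simp add: loewner_ge_def G_def Y_def T_def)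
qed

end
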